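(* Let $T>1$ and let $N=2n+1$ be an odd positive integer. For all $x,y\in[-1,1]$, $$K_N(x,y)=\mathrm{Imag}\left(\frac{\overline{e^{-\frac{i\pi}{T}\frac N2y}\cdot\Pi_N\left(e^{\frac{i\pi}{T}y}\right)}\cdot e^{-\frac{i\pi}{T}\frac N2x}\cdot\Pi_N\left(e^{\frac{i\pi}{T}x}\right)}{\sin\left(\frac{\pi}{2T}(x-y)\right)}\right).$$ The formula in fact holds for all $x,y\in[-T,T]$.
   Context: Fix $T>1$. For odd $N=2n+1$ let $\mathcal{H}_N=\mathrm{span}\{e^{\frac{i\pi}{T}kx}\}_{k=-n}^{n}$. The prolate kernel is $K_N(x,y)=\sum_{k=1}^Ne_k(x)\overline{e_k(y)}$, where $\{e_k\}_{k=1}^N$ is any basis of $\mathcal{H}_N$ orthonormal with respect to the $L^2(-1,1)$ inner product (the kernel is independent of the choice); since the $e_k$ are trigonometric polynomials, the same formula defines $K_N(x,y)$ for all real $x,y$. $\{\Pi_k\}_{k=0}^\infty$ are the normalized orthogonal polynomials on the unit circle, $\deg\Pi_k=k$, for the weight $f(\theta)=2T\cdot\chi_{[-\frac{\pi}{T},\frac{\pi}{T}]}(\theta)$, $\theta\in[-\pi,\pi]$ ($\chi$ denoting the indicator function), i.e. $\frac1{2\pi}\int_{-\pi}^{\pi}\overline{\Pi_k(e^{i\theta})}\,\Pi_j(e^{i\theta})f(\theta)\,d\theta=\delta_{j,k}$ for $j,k=0,1,2,\ldots$. $\mathrm{Imag}$ denotes the imaginary part. Where the denominator vanishes (e.g.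 $x=y$), the right-hand side is understood as its continuous extension. *)

theory Defs
  imports "HOL-Analysis.Analysis" "HOL-Library.Function_Algebras" "HOL-Computational_Algebra.Polynomial"
begin

definition cfun_scale :: "complex \<Rightarrow> (real \<Rightarrow> complex) \<Rightarrow> real \<Rightarrow> complex" where
  "cfun_scale c f = (\<lambda>x. c * f x)"

(* The vector space over the complex numbers of all functions from the reals to the
   complex numbers; cfun.span is the complex linear span. *)
interpretation cfun: vector_space cfun_scale
  by unfold_locales (auto simp: cfun_scale_def algebra_simps fun_eq_iff)

definition trig_space :: "real \<Rightarrow> nat \<Rightarrow> (real \<Rightarrow> complex) set" where
  "trig_space T n =
     cfun.span ((\<lambda>k x. exp (\<i> * of_real (pi / T) * of_int k * of_real x)) ` {- int n..int n})"

definition L2_inner :: "(real \<Rightarrow> complex) \<Rightarrow> (real \<Rightarrow> complex) \<Rightarrow> complex" where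
  "L2_inner f g = (LINT x:{-1<..<1}|lborel. f x * cnj (g x))"

(* Linear independence is not listed separately: it follows from orthonormality. *)
definition orthonormal_basis ::
  "real \<Rightarrow> nat \<Rightarrow> (nat \<Rightarrow> real \<Rightarrow> complex) \<Rightarrow> bool" where
  "orthonormal_basis T n e \<longleftrightarrow>
     cfun.span (e ` {1..2 * n + 1}) = trig_space T n \<and>
     (\<forall>j\<in>{1..2 * n + 1}. \<forall>k\<in>{1..2 * n + 1}. L2_inner (e j) (e k) = (if j = k then 1 else 0))"

definition prolate_kernel ::
  "nat \<Rightarrow> (nat \<Rightarrow> real \<Rightarrow> complex) \<Rightarrow> real \<Rightarrow> real \<Rightarrow> complex" where
  "prolate_kernel N e x y = (\<Sum>k=1..N. e k x * cnj (e k y))"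

definition opuc_weight :: "real \<Rightarrow> real \<Rightarrow> real" where
  "opuc_weight T \<theta> = 2 * T * indicator {- pi / T..pi / T} \<theta>"

(* The conditions determine each polynomial up to a unimodular constant; no choice of its
   phase is imposed. *)
definition orthonormal_polys_unit_circle ::
  "(real \<Rightarrow> real) \<Rightarrow> (nat \<Rightarrow> complex poly) \<Rightarrow> bool" where
  "orthonormal_polys_unit_circle f P \<longleftrightarrow>
     (\<forall>k. degree (P k) = k) \<and>
     (\<forall>j k. 1 / (2 * of_real pi) *
        (LINT \<theta>:{-pi..pi}|lborel.
           cnj (poly (P k) (exp (\<i> * of_real \<theta>))) * poly (P j) (exp (\<i> * of_real \<theta>)) * of_real (f \<theta>))
        = (if j = k then 1 else 0))"

definition cd_quotient :: "real \<Rightarrow> nat \<Rightarrow> complex poly \<Rightarrow> real \<Rightarrow> real \<Rightarrow> real" where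
  "cd_quotient T N p x y =
     Im (cnj (exp (- (\<i> * of_real (pi / T) * of_real (real N / 2) * of_real y)) *
              poly p (exp (\<i> * of_real (pi / T) * of_real y))) *
         exp (- (\<i> * of_real (pi / T) * of_real (real N / 2) * of_real x)) *
         poly p (exp (\<i> * of_real (pi / T) * of_real x)) /
         of_real (sin (pi / (2 * T) * (x - y))))"

(* Division by zero yields zero in HOL, so where the sine vanishes the value is taken to be
   the (two-variable) limit over the points where it does not. Lim is arbitrary when no limit
   exists, so continuity of the resulting function has to be asserted where it is used. *)
definition cd_formula :: "real \<Rightarrow> nat \<Rightarrow> complex poly \<Rightarrow> real \<Rightarrow> real \<Rightarrow> real" where
  "cd_formula T N p x y =
     (if sin (pi / (2 * T) * (x - y)) \<noteq> 0 then cd_quotient T N p x y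
      else Lim (at (x, y) within {(u, v). sin (pi / (2 * T) * (u - v)) \<noteq> 0})
             (\<lambda>(u, v). cd_quotient T N p u v))"

end

theory Submission
  imports Defs
begin

text \<open>
  The substitution \<open>\<theta> = \<pi> x / T\<close> turns the inner product of the unit circle with the given
  weight into the \<open>L\<^sup>2(-1,1)\<close> inner product, because the arc carrying the weight is the image of
  \<open>[-1,1]\<close>.  Write \<open>E x = exp (i \<pi> x / T)\<close>.  The functions \<open>\<Pi>\<^sub>k (E x)\<close>, \<open>k < N\<close>, multiplied by
  \<open>E x\<close> to the power \<open>-n\<close>, are therefore an orthonormal basis of the trigonometric space.  The kernel
  \<open>\<Sum>k. e\<^sub>k x * cnj (e\<^sub>k y)\<close> of an orthonormal family depends only on its span
  (\<open>reproducing_kernel_unique\<close>), so the prolate kernel is, up to a unimodular factor, the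
  Christoffel--Darboux sum of the \<open>\<Pi>\<^sub>k\<close> (\<open>prolate_kernel_eq\<close>).

  The Christoffel--Darboux formula on the circle (\<open>christoffel_darboux\<close>) follows from the same
  uniqueness: the polynomials of degree at most \<open>N\<close> have, besides \<open>\<Pi>\<^sub>0, ..., \<Pi>\<^sub>N\<close>, the orthonormal
  basis consisting of all \<open>z \<Pi>\<^sub>k\<close> with \<open>k < N\<close> and the reversed polynomial of \<open>\<Pi>\<^sub>N\<close>, which on the
  circle is \<open>z ^ N * cnj (\<Pi>\<^sub>N z)\<close>.  Equating the two kernels and solving for the sum over \<open>k < N\<close>
  gives the formula, without using the Szego recurrence.  Dividing by
  \<open>1 - E x * cnj (E y)\<close>, which is the sine times a nonvanishing factor, yields the claim wherever the
  sine does not vanish.  The prolate kernel is continuous everywhere and the zeros of the sine are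
  limit points of the set where it does not vanish, so the identity extends to them.
\<close>

section \<open>The inner product on continuous functions\<close>

lemma set_integrable_L2:
  fixes f :: "real \<Rightarrow> complex"
  assumes "continuous_on UNIV f"
  shows "set_integrable lborel {-1<..<1} f"
proof (rule set_integrable_subset)
  show "set_integrable lborel {-1..1} f"
    unfolding set_integrable_def
    by (intro borel_integrable_compact continuous_on_subset[OF assms]) auto
qed auto

lemma L2_inner_add:
  assumes "continuous_on UNIV f" "continuous_on UNIV g" "continuous_on UNIV h"
  shows "L2_inner (f + g) h = L2_inner f h + L2_inner g h"
  unfolding L2_inner_def plus_fun_def distrib_right
  by (intro set_integral_add set_integrable_L2 continuous_intros assms)

lemma L2_inner_scale: "L2_inner (cfun_scale c f) h = c * L2_inner f h"
  by (simp add: L2_inner_def cfun_scale_def mult.assoc)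

lemma L2_inner_cnj: "cnj (L2_inner f g) = L2_inner g f"
proof -
  have "L2_inner g f = (LINT x|lborel. cnj (indicator {-1<..<1} x *\<^sub>R (f x * cnj (g x))))"
    unfolding L2_inner_def set_lebesgue_integral_def
    by (intro Bochner_Integration.integral_cong) (auto simp: indicator_def)
  also have "\<dots> = cnj (L2_inner f g)"
    unfolding L2_inner_def set_lebesgue_integral_def by (rule Bochner_Integration.integral_cnj)
  finally show ?thesis by simp
qed

lemma L2_inner_zero [simp]: "L2_inner 0 h = 0"
  by (simp add: L2_inner_def)

lemma L2_inner_cong:
  assumes "\<And>x. f x * cnj (g x) = f' x * cnj (g' x)"
  shows "L2_inner f g = L2_inner f' g'"
  unfolding L2_inner_def using assms by simp

lemma continuous_on_span:
  assumes "\<And>f. f \<in> S \<Longrightarrow> continuous_on UNIV f" and "f \<in> cfun.span S"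
  shows "continuous_on UNIV f"
  using assms(2)
proof (induction rule: cfun.span_induct_alt)
  case base
  show ?case by (simp add: zero_fun_def)
next
  case (step c g h)
  then show ?case
    using assms(1)[of g] by (auto simp: plus_fun_def cfun_scale_def intro!: continuous_intros)
qed

lemma L2_inner_span_eq_0:
  assumes "\<And>f. f \<in> S \<Longrightarrow> continuous_on UNIV f" "continuous_on UNIV h"
    and "\<And>f. f \<in> S \<Longrightarrow> L2_inner f h = 0" and "f \<in> cfun.span S"
  shows "L2_inner f h = 0"
proof -
  have "continuous_on UNIV f \<and> L2_inner f h = 0"
    using assms(4)
  proof (induction rule: cfun.span_induct_alt)
    case base
    show ?case by (simp add: zero_fun_def[symmetric])
  next
    case (step c g k)
    have "continuous_on UNIV (cfun_scale c g)"
      using assms(1)[OF step(1)] by (auto simp: cfun_scale_def intro!: continuous_intros)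
    moreover from this have "continuous_on UNIV (cfun_scale c g + k)"
      using step by (auto simp: plus_fun_def intro!: continuous_intros)
    moreover have "L2_inner (cfun_scale c g + k) h = c * L2_inner g h + L2_inner k h"
      using step assms(2) \<open>continuous_on UNIV (cfun_scale c g)\<close>
      by (subst L2_inner_add) (auto simp: L2_inner_scale)
    ultimately show ?case
      using step assms(3) by (simp add: plus_fun_def)
  qed
  then show ?thesis ..
qed

section \<open>Reproducing kernels\<close>

text \<open>
  Orthonormality in \<open>L\<^sup>2(-1,1)\<close>.  Continuity on the whole line is part of the notion: it makes all
  products integrable, so that the inner product is additive on the span of the family.
\<close>

definition L2_orthonormal :: "'i set \<Rightarrow> ('i \<Rightarrow> real \<Rightarrow> complex) \<Rightarrow> bool" where
  "L2_orthonormal A g \<longleftrightarrow>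
     (\<forall>k\<in>A. continuous_on UNIV (g k)) \<and>
     (\<forall>j\<in>A. \<forall>k\<in>A. L2_inner (g j) (g k) = (if j = k then 1 else 0))"

lemma L2_orthonormal_expansion:
  assumes "finite A" "L2_orthonormal A g" "f \<in> cfun.span (g ` A)"
  shows "f x = (\<Sum>k\<in>A. L2_inner f (g k) * g k x)"
proof -
  have cont: "continuous_on UNIV (g k)" if "k \<in> A" for k
    using assms(2) that by (auto simp: L2_orthonormal_def)
  have "continuous_on UNIV f \<and> (\<forall>x. f x = (\<Sum>k\<in>A. L2_inner f (g k) * g k x))"
    using assms(3)
  proof (induction rule: cfun.span_induct_alt)
    case base
    have "continuous_on UNIV (0 :: real \<Rightarrow> complex)" by (simp add: zero_fun_def)
    then show ?case by (simp add: L2_inner_def)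
  next
    case (step c h k)
    then obtain j where j: "j \<in> A" "h = g j" by auto
    have ch: "continuous_on UNIV (cfun_scale c h)"
      using cont j by (auto simp: cfun_scale_def intro!: continuous_intros)
    then have c': "continuous_on UNIV (cfun_scale c h + k)"
      unfolding plus_fun_def by (intro continuous_intros conjunct1[OF step(2)])
    have "(cfun_scale c h + k) x = (\<Sum>i\<in>A. L2_inner (cfun_scale c h + k) (g i) * g i x)" for x
    proof -
      have "L2_inner (cfun_scale c h + k) (g i) * g i x
          = (if i = j then c * g j x else 0) + L2_inner k (g i) * g i x" if "i \<in> A" for i
        using L2_inner_add[OF ch conjunct1[OF step(2)] cont[OF that]] that j assms(2)
        by (simp add: L2_inner_scale L2_orthonormal_def distrib_right)
      then have "(\<Sum>i\<in>A. L2_inner (cfun_scale c h + k) (g i) * g i x)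
          = (\<Sum>i\<in>A. (if i = j then c * g j x else 0) + L2_inner k (g i) * g i x)"
        by (intro sum.cong refl)
      also have "\<dots> = c * g j x + k x"
        using j(1) assms(1) conjunct2[OF step(2), rule_format, of x] by (simp add: sum.distrib)
      finally show ?thesis using j by (simp add: cfun_scale_def)
    qed
    with c' show ?case by (intro conjI allI)
  qed
  then show ?thesis by blast
qed

text \<open>
  Expanding each \<open>e\<^sub>j\<close> in the family \<open>g\<close> and exchanging the two sums leaves, under the conjugate,
  the expansion of \<open>g\<^sub>k\<close> in the family \<open>e\<close>.
\<close>

lemma reproducing_kernel_unique:
  assumes "finite A" "finite B" "L2_orthonormal A e" "L2_orthonormal B g"
    and "cfun.span (e ` A) = cfun.span (g ` B)"
  shows "(\<Sum>j\<in>A. e j x * cnj (e j y)) = (\<Sum>k\<in>B. g k x * cnj (g k y))"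
proof -
  have e: "e j x = (\<Sum>k\<in>B. L2_inner (e j) (g k) * g k x)" if "j \<in> A" for j x
    by (rule L2_orthonormal_expansion[OF assms(2,4)])
       (unfold assms(5)[symmetric], rule cfun.span_base, rule imageI[OF that])
  have g: "g k x = (\<Sum>j\<in>A. L2_inner (g k) (e j) * e j x)" if "k \<in> B" for k x
    by (rule L2_orthonormal_expansion[OF assms(1,3)])
       (unfold assms(5), rule cfun.span_base, rule imageI[OF that])
  have "(\<Sum>j\<in>A. e j x * cnj (e j y))
      = (\<Sum>j\<in>A. \<Sum>k\<in>B. L2_inner (e j) (g k) * g k x * cnj (e j y))"
    by (intro sum.cong refl) (simp only: sum_distrib_right[symmetric] e[symmetric])
  also have "\<dots> = (\<Sum>k\<in>B. \<Sum>j\<in>A. L2_inner (e j) (g k) * g k x * cnj (e j y))"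
    by (rule sum.swap)
  also have "\<dots> = (\<Sum>k\<in>B. g k x * cnj (\<Sum>j\<in>A. L2_inner (g k) (e j) * e j y))"
    unfolding cnj_sum sum_distrib_left complex_cnj_mult L2_inner_cnj
    by (intro sum.cong refl) (simp only: mult_ac)
  also have "\<dots> = (\<Sum>k\<in>B. g k x * cnj (g k y))"
    by (intro sum.cong refl) (simp only: g[symmetric])
  finally show ?thesis .
qed

section \<open>Triangular changes of basis\<close>

lemma (in vector_space) span_triangular:
  fixes b f :: "nat \<Rightarrow> 'b"
  assumes f: "\<And>k. k < m \<Longrightarrow> f k = (\<Sum>i\<le>k. scale (a k i) (b i))"
    and diag: "\<And>k. k < m \<Longrightarrow> a k k \<noteq> 0"
  shows "span (f ` {..<m}) = span (b ` {..<m})"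
proof -
  have "f k \<in> span (b ` {..<m})" if "k < m" for k
    unfolding f[OF that] using that by (intro span_sum span_scale span_base) auto
  moreover have "b k \<in> span (f ` {..<m})" if "k < m" for k
    using that
  proof (induction k rule: less_induct)
    case (less k)
    have "f k = scale (a k k) (b k) + (\<Sum>i<k. scale (a k i) (b i))"
      using f[OF less.prems] by (simp add: lessThan_Suc_atMost[symmetric] add.commute)
    then have "scale (a k k) (b k) = f k - (\<Sum>i<k. scale (a k i) (b i))"
      by (simp add: algebra_simps)
    also have "\<dots> \<in> span (f ` {..<m})"
      using less by (intro span_diff span_sum span_scale) (auto intro: span_base)
    finally have "scale (inverse (a k k)) (scale (a k k) (b k)) \<in> span (f ` {..<m})"
      by (rule span_scale)
    then show ?case using diag[OF less.prems] by simp
  qed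
  ultimately show ?thesis by (subst span_eq) auto
qed

section \<open>Polynomials on the unit circle as functions of a real variable\<close>

text \<open>
  The point of the unit circle with angle \<open>\<pi> x / T\<close>; the interval \<open>[-1,1]\<close> parametrizes the arc on
  which the weight is positive.
\<close>

definition circle_point :: "real \<Rightarrow> real \<Rightarrow> complex" where
  "circle_point T x = exp (\<i> * of_real (pi / T) * of_real x)"

lemma continuous_circle_point [continuous_intros]: "continuous_on A (circle_point T)"
  unfolding circle_point_def by (intro continuous_intros)

lemma circle_point_nonzero [simp]: "circle_point T x \<noteq> 0"
  unfolding circle_point_def by simp

lemma cnj_circle_point: "cnj (circle_point T x) = inverse (circle_point T x)"
  unfolding circle_point_def by (simp flip: exp_minus add: exp_cnj)

lemma circle_point_mult_cnj [simp]: "circle_point T x * cnj (circle_point T x) = 1"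
  by (simp add: cnj_circle_point)

lemma circle_point_power_diff:
  assumes "i \<le> N"
  shows "circle_point T x ^ (N - i) = circle_point T x ^ N * cnj (circle_point T x) ^ i"
  using assms by (simp add: cnj_circle_point power_diff power_inverse divide_inverse)

lemma integral_circle_arc:
  fixes G :: "complex \<Rightarrow> complex"
  assumes "T > 1"
  shows "1 / (2 * of_real pi) *
      (LINT \<theta>:{-pi..pi}|lborel. G (exp (\<i> * of_real \<theta>)) * of_real (opuc_weight T \<theta>))
    = (LINT x:{-1<..<1}|lborel. G (circle_point T x))"
proof -
  \<comment> \<open>Since \<open>T > 1\<close>, the arc stays inside the range of integration \<open>[-\<pi>, \<pi>]\<close>.\<close>
  have iff1: "- pi \<le> pi / T * x \<and> pi / T * x \<le> pi" if "-1 \<le> x" "x \<le> 1" for x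
  proof -
    have "\<bar>pi / T * x\<bar> \<le> pi * 1"
      unfolding abs_mult using that assms by (intro mult_mono) (auto simp: field_simps)
    then show ?thesis unfolding abs_le_iff by linarith
  qed
  have iff2: "- pi / T \<le> pi / T * x \<and> pi / T * x \<le> pi / T \<longleftrightarrow> -1 \<le> x \<and> x \<le> 1" for x
  proof -
    have "pi / T * (-1) \<le> pi / T * x \<longleftrightarrow> -1 \<le> x"
      using assms by (intro mult_le_cancel_left_pos) auto
    moreover have "pi / T * x \<le> pi / T * 1 \<longleftrightarrow> x \<le> 1"
      using assms by (intro mult_le_cancel_left_pos) auto
    ultimately show ?thesis by simp
  qed
  have "(LINT \<theta>:{-pi..pi}|lborel. G (exp (\<i> * of_real \<theta>)) * of_real (opuc_weight T \<theta>))
     = \<bar>pi / T\<bar> *\<^sub>R (LINT x|lborel. indicator {-pi..pi} (0 + pi / T * x) *\<^sub>R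
          (G (exp (\<i> * of_real (0 + pi / T * x))) * of_real (opuc_weight T (0 + pi / T * x))))"
    unfolding set_lebesgue_integral_def using assms by (intro lborel_integral_real_affine) auto
  also have "(LINT x|lborel. indicator {-pi..pi} (0 + pi / T * x) *\<^sub>R
          (G (exp (\<i> * of_real (0 + pi / T * x))) * of_real (opuc_weight T (0 + pi / T * x))))
     = (LINT x|lborel. (2 * T) *\<^sub>R indicator {-1..1} x *\<^sub>R G (circle_point T x))"
    using iff1 iff2
    by (intro Bochner_Integration.integral_cong refl)
       (auto simp: indicator_def opuc_weight_def circle_point_def mult.assoc scaleR_conv_of_real)
  also have "\<dots> = (2 * T) *\<^sub>R (LINT x:{-1..1}|lborel. G (circle_point T x))"
    unfolding set_lebesgue_integral_def scaleR_scaleR[of "2 * T", symmetric] by (rule integral_scaleR_right)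
  also have "(LINT x:{-1..1}|lborel. G (circle_point T x))
     = (LINT x:{-1<..<1}|lborel. G (circle_point T x))"
    unfolding set_lebesgue_integral_def
    by (rule integral_discrete_difference[where X = "{-1,1}"]) (auto simp: indicator_def)
  finally show ?thesis
    using assms by (simp add: scaleR_conv_of_real field_simps)
qed

lemma L2_orthonormal_opuc:
  assumes "T > 1" "orthonormal_polys_unit_circle (opuc_weight T) P"
  shows "L2_orthonormal A (\<lambda>k x. poly (P k) (circle_point T x))"
proof -
  have "L2_inner (\<lambda>x. poly (P j) (circle_point T x)) (\<lambda>x. poly (P k) (circle_point T x))
      = (if j = k then 1 else 0)" for j k
    using assms(2) integral_circle_arc[OF assms(1), of "\<lambda>z. cnj (poly (P k) z) * poly (P j) z"]
    unfolding orthonormal_polys_unit_circle_def L2_inner_def by (simp add: mult.commute)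
  then show ?thesis
    unfolding L2_orthonormal_def by (auto intro!: continuous_intros)
qed

lemma opuc_lead_coeff:
  assumes "T > 1" "orthonormal_polys_unit_circle (opuc_weight T) P"
  shows "coeff (P k) k \<noteq> 0"
proof
  assume *: "coeff (P k) k = 0"
  have "degree (P k) = k"
    using assms(2) by (simp add: orthonormal_polys_unit_circle_def)
  with * have "P k = 0" by (metis leading_coeff_0_iff)
  moreover have "L2_inner (\<lambda>x. poly (P k) (circle_point T x)) (\<lambda>x. poly (P k) (circle_point T x)) = 1"
    using L2_orthonormal_opuc[OF assms, of UNIV] by (auto simp: L2_orthonormal_def)
  ultimately show False by (simp add: L2_inner_def)
qed

lemma sum_fun_apply: "(\<Sum>i\<in>A. f i) x = (\<Sum>i\<in>A. (f i x :: complex))"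
  by (induction A rule: infinite_finite_induct) auto

text \<open>
  The factor \<open>h\<close> allows the powers to be shifted, in particular to the frequencies \<open>-n, ..., n\<close>.
\<close>

lemma span_opuc:
  assumes "T > 1" "orthonormal_polys_unit_circle (opuc_weight T) P"
  shows "cfun.span ((\<lambda>k x. h x * poly (P k) (circle_point T x)) ` {..<m})
       = cfun.span ((\<lambda>k x. h x * circle_point T x ^ k) ` {..<m})"
proof (rule cfun.span_triangular[where a = "\<lambda>k. coeff (P k)"])
  fix k
  have "degree (P k) = k"
    using assms(2) by (simp add: orthonormal_polys_unit_circle_def)
  then show "(\<lambda>x. h x * poly (P k) (circle_point T x))
      = (\<Sum>i\<le>k. cfun_scale (coeff (P k) i) (\<lambda>x. h x * circle_point T x ^ i))"
    by (simp add: fun_eq_iff sum_fun_apply cfun_scale_def poly_altdef sum_distrib_left mult_ac)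
  show "coeff (P k) k \<noteq> 0" by (rule opuc_lead_coeff[OF assms])
qed

section \<open>The Christoffel--Darboux formula\<close>

text \<open>
  The index \<open>N\<close> of the family carries the reversed polynomial of \<open>\<Pi>\<^sub>N\<close>, whose constant coefficient
  is the conjugate of the nonzero leading coefficient of \<open>\<Pi>\<^sub>N\<close>.
\<close>

lemma span_reversed_opuc:
  assumes "T > 1" "orthonormal_polys_unit_circle (opuc_weight T) P"
  shows "cfun.span ((\<lambda>k x. if k < N then circle_point T x * poly (P k) (circle_point T x)
                         else circle_point T x ^ N * cnj (poly (P N) (circle_point T x))) ` {..<Suc N})
       = cfun.span ((\<lambda>k x. circle_point T x ^ k) ` {..<Suc N})"
    (is "cfun.span (?f ` _) = cfun.span (?b ` _)")
proof -
  have deg: "degree (P k) = k" for k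
    using assms(2) by (simp add: orthonormal_polys_unit_circle_def)
  \<comment> \<open>In the ordering \<open>1, 2, ..., N, 0\<close> of the powers, the change of basis is triangular.\<close>
  define b where "b = (\<lambda>k x. circle_point T x ^ (if k < N then Suc k else 0))"
  define a where "a = (\<lambda>k i. if k < N then coeff (P k) i
     else if i = N then cnj (coeff (P N) N) else cnj (coeff (P N) (N - Suc i)))"
  have "cfun.span (?f ` {..<Suc N}) = cfun.span (b ` {..<Suc N})"
  proof (rule cfun.span_triangular[where a = a])
    fix k assume k: "k < Suc N"
    show "a k k \<noteq> 0" using opuc_lead_coeff[OF assms] k by (auto simp: a_def)
    show "?f k = (\<Sum>i\<le>k. cfun_scale (a k i) (b i))"
    proof (cases "k < N")
      case True
      then show ?thesis
        by (simp add: fun_eq_iff sum_fun_apply cfun_scale_def poly_altdef sum_distrib_left mult_ac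
            deg a_def b_def)
    next
      case False
      then have [simp]: "k = N" using k by simp
      have "circle_point T x ^ N * cnj (poly (P N) (circle_point T x))
          = (\<Sum>i\<le>N. cfun_scale (a N i) (b i)) x" for x
      proof -
        have "circle_point T x ^ N * cnj (poly (P N) (circle_point T x))
            = (\<Sum>i\<le>N. cnj (coeff (P N) i) * circle_point T x ^ (N - i))"
          by (auto simp: poly_altdef deg sum_distrib_left circle_point_power_diff intro!: sum.cong)
        also have "\<dots> = (\<Sum>i<N. cnj (coeff (P N) i) * circle_point T x ^ (N - i)) + cnj (coeff (P N) N)"
          by (simp flip: lessThan_Suc_atMost)
        also have "(\<Sum>i<N. cnj (coeff (P N) i) * circle_point T x ^ (N - i))
          = (\<Sum>i<N. cnj (coeff (P N) (N - Suc i)) * circle_point T x ^ (N - (N - Suc i)))"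
          by (rule sum.nat_diff_reindex[symmetric])
        also have "\<dots> + cnj (coeff (P N) N) = (\<Sum>i\<le>N. a N i * b i x)"
          by (auto simp: a_def b_def simp flip: lessThan_Suc_atMost intro!: sum.cong arg_cong2[where f = "(^)"])
        finally show ?thesis by (simp add: sum_fun_apply cfun_scale_def)
      qed
      then show ?thesis by auto
    qed
  qed
  also have "b ` {..<Suc N} = ?b ` {..<Suc N}"
  proof -
    have "b ` {..<Suc N} = ?b ` (\<lambda>k. if k < N then Suc k else 0) ` {..<Suc N}"
      unfolding b_def image_image ..
    also have "(\<lambda>k. if k < N then Suc k else 0) ` {..<Suc N} = {..<Suc N}"
    proof -
      have "j \<in> (\<lambda>k. if k < N then Suc k else 0) ` {..<Suc N}" if "j < Suc N" for j
        using that by (cases j) (auto intro!: image_eqI[of _ _ "if j = 0 then N else j - 1"])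
      then show ?thesis by auto
    qed
    finally show ?thesis .
  qed
  finally show ?thesis .
qed

text \<open>
  Conjugating and multiplying by a power of \<open>z\<close> turns the orthogonality of the reversed polynomial to
  \<open>z \<Pi>\<^sub>k\<close>, for \<open>k < N\<close>, into the orthogonality of \<open>\<Pi>\<^sub>N\<close> to a polynomial of degree less than \<open>N\<close>.
\<close>

lemma orthonormal_reversed_opuc:
  assumes "T > 1" "orthonormal_polys_unit_circle (opuc_weight T) P"
  shows "L2_orthonormal {..<Suc N}
      (\<lambda>k x. if k < N then circle_point T x * poly (P k) (circle_point T x)
             else circle_point T x ^ N * cnj (poly (P N) (circle_point T x)))"
    (is "L2_orthonormal _ ?f")
proof -
  define u where "u = (\<lambda>k x. poly (P k) (circle_point T x))"
  define E where "E = circle_point T"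
  have EE: "E x ^ m * (cnj (E x)) ^ m = 1" for x m
    by (simp add: E_def flip: power_mult_distrib)
  have deg: "degree (P k) = k" for k
    using assms(2) by (simp add: orthonormal_polys_unit_circle_def)
  have cu: "continuous_on UNIV (u k)" and on: "L2_inner (u j) (u k) = (if j = k then 1 else 0)" for j k
    using L2_orthonormal_opuc[OF assms, of UNIV] by (auto simp: L2_orthonormal_def u_def)
  have uu: "L2_inner (\<lambda>x. E x * u j x) (\<lambda>x. E x * u k x) = (if j = k then 1 else 0)" for j k
    unfolding on[symmetric]
  proof (rule L2_inner_cong)
    fix x
    show "E x * u j x * cnj (E x * u k x) = u j x * cnj (u k x)"
      using EE[of x 1] by (simp add: algebra_simps)
  qed
  have vv: "L2_inner (\<lambda>x. E x ^ N * cnj (u N x)) (\<lambda>x. E x ^ N * cnj (u N x)) = 1"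
  proof -
    have "L2_inner (\<lambda>x. E x ^ N * cnj (u N x)) (\<lambda>x. E x ^ N * cnj (u N x)) = L2_inner (u N) (u N)"
    proof (rule L2_inner_cong)
      fix x
      have "E x ^ N * cnj (u N x) * cnj (E x ^ N * cnj (u N x))
         = (E x ^ N * (cnj (E x)) ^ N) * (u N x * cnj (u N x))" by simp
      then show "E x ^ N * cnj (u N x) * cnj (E x ^ N * cnj (u N x)) = u N x * cnj (u N x)"
        by (simp only: EE mult_1)
    qed
    then show ?thesis using on by simp
  qed
  have vu: "L2_inner (\<lambda>x. E x ^ N * cnj (u N x)) (\<lambda>x. E x * u k x) = 0" if k: "k < N" for k
  proof -
    define w where "w = (\<lambda>x. E x ^ (N - 1) * cnj (u k x))"
    have "w = (\<Sum>i\<le>k. cfun_scale (cnj (coeff (P k) i)) (\<lambda>x. E x ^ (N - 1 - i)))"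
      using k
      by (auto simp: w_def u_def fun_eq_iff sum_fun_apply cfun_scale_def poly_altdef deg E_def
          sum_distrib_left circle_point_power_diff intro!: sum.cong)
    also have "\<dots> \<in> cfun.span ((\<lambda>k x. 1 * E x ^ k) ` {..<N})"
      using k by (intro cfun.span_sum cfun.span_scale cfun.span_base) auto
    also have "\<dots> = cfun.span ((\<lambda>k x. 1 * poly (P k) (circle_point T x)) ` {..<N})"
      unfolding E_def by (rule span_opuc[OF assms, symmetric])
    also have "\<dots> = cfun.span (u ` {..<N})" by (simp add: u_def)
    finally have w: "w \<in> cfun.span (u ` {..<N})" .
    have "L2_inner (\<lambda>x. E x ^ N * cnj (u N x)) (\<lambda>x. E x * u k x) = L2_inner w (u N)"
    proof (rule L2_inner_cong)
      fix x
      have "E x ^ N = E x * E x ^ (N - 1)" using k by (cases N) auto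
      then have "E x ^ N * cnj (u N x) * cnj (E x * u k x)
           = (E x ^ 1 * (cnj (E x)) ^ 1) * (w x * cnj (u N x))" by (simp add: w_def)
      then show "E x ^ N * cnj (u N x) * cnj (E x * u k x) = w x * cnj (u N x)"
        by (simp only: EE mult_1)
    qed
    also have "\<dots> = 0"
      by (rule L2_inner_span_eq_0[OF _ _ _ w]) (use cu on in auto)
    finally show ?thesis .
  qed
  have uv: "L2_inner (\<lambda>x. E x * u k x) (\<lambda>x. E x ^ N * cnj (u N x)) = 0" if "k < N" for k
    using vu[OF that] L2_inner_cnj by (metis complex_cnj_zero)
  have f: "?f k = (if k < N then (\<lambda>x. E x * u k x) else (\<lambda>x. E x ^ N * cnj (u N x)))" for k
    by (auto simp: E_def u_def)
  have "continuous_on UNIV (?f k)" for k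
    by (cases "k < N") (auto intro!: continuous_intros)
  moreover have "L2_inner (?f j) (?f k) = (if j = k then 1 else 0)" if "j < Suc N" "k < Suc N" for j k
    using that uu vv vu uv unfolding f by (cases "j < N"; cases "k < N") auto
  ultimately show ?thesis unfolding L2_orthonormal_def by auto
qed

text \<open>
  Both points lie on the unit circle; there the reversed polynomial of \<open>\<Pi>\<^sub>N\<close> takes the value
  \<open>z ^ N * cnj (\<Pi>\<^sub>N z)\<close>.
\<close>

lemma christoffel_darboux:
  fixes x y :: real
  assumes "T > 1" "orthonormal_polys_unit_circle (opuc_weight T) P"
  defines "z \<equiv> circle_point T x" and "w \<equiv> circle_point T y"
  shows "(1 - z * cnj w) * (\<Sum>k<N. poly (P k) z * cnj (poly (P k) w))
       = z ^ N * cnj (poly (P N) z) * cnj (w ^ N * cnj (poly (P N) w))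
         - poly (P N) z * cnj (poly (P N) w)"
proof -
  have rearrange: "(1 - c) * S = r - p" if "S + p = c * S + r" for c S p r :: complex
    using that by (simp add: algebra_simps)
  define f where "f = (\<lambda>k x. if k < N then circle_point T x * poly (P k) (circle_point T x)
             else circle_point T x ^ N * cnj (poly (P N) (circle_point T x)))"
  have "(\<Sum>k<Suc N. poly (P k) z * cnj (poly (P k) w)) = (\<Sum>k<Suc N. f k x * cnj (f k y))"
    unfolding z_def w_def
  proof (rule reproducing_kernel_unique)
    show "L2_orthonormal {..<Suc N} (\<lambda>k x. poly (P k) (circle_point T x))"
      by (rule L2_orthonormal_opuc[OF assms(1,2)])
    show "L2_orthonormal {..<Suc N} f"
      unfolding f_def by (rule orthonormal_reversed_opuc[OF assms(1,2)])
    show "cfun.span ((\<lambda>k x. poly (P k) (circle_point T x)) ` {..<Suc N}) = cfun.span (f ` {..<Suc N})"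
      unfolding f_def span_reversed_opuc[OF assms(1,2)]
      using span_opuc[OF assms(1,2), of "\<lambda>_. 1" "Suc N"] by simp
  qed auto
  also have "\<dots> = z * cnj w * (\<Sum>k<N. poly (P k) z * cnj (poly (P k) w))
       + z ^ N * cnj (poly (P N) z) * cnj (w ^ N * cnj (poly (P N) w))"
    by (simp add: f_def z_def w_def sum_distrib_left mult_ac)
  finally show ?thesis
    unfolding sum.lessThan_Suc by (rule rearrange)
qed

section \<open>The prolate kernel\<close>

lemma trig_space_eq:
  "trig_space T n = cfun.span ((\<lambda>k x. cnj (circle_point T x) ^ n * circle_point T x ^ k) ` {..<2 * n + 1})"
proof -
  have "{- int n..int n} = (\<lambda>k. int k - int n) ` {..<2 * n + 1}"
  proof (intro set_eqI iffI)
    fix j assume "j \<in> {- int n..int n}"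
    then show "j \<in> (\<lambda>k. int k - int n) ` {..<2 * n + 1}"
      by (intro image_eqI[of _ _ "nat (j + int n)"]) auto
  qed auto
  moreover have "exp (\<i> * of_real (pi / T) * of_int (int k - int n) * of_real x)
      = cnj (circle_point T x) ^ n * circle_point T x ^ k" for k x
    unfolding circle_point_def
    by (simp add: exp_cnj flip: exp_of_nat_mult exp_add) (simp add: algebra_simps diff_divide_distrib)
  ultimately show ?thesis unfolding trig_space_def by (simp add: image_image)
qed

lemma continuous_on_trig_space:
  assumes "f \<in> trig_space T n"
  shows "continuous_on UNIV f"
  using assms unfolding trig_space_eq
  by (rule continuous_on_span[rotated]) (auto intro!: continuous_intros)

lemma orthonormal_basis_continuous:
  assumes "orthonormal_basis T n e" "k \<in> {1..2 * n + 1}"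
  shows "continuous_on UNIV (e k)"
proof (rule continuous_on_trig_space)
  have "e k \<in> cfun.span (e ` {1..2 * n + 1})"
    using assms(2) by (intro cfun.span_base imageI)
  then show "e k \<in> trig_space T n"
    using assms(1) unfolding orthonormal_basis_def by blast
qed

lemma prolate_kernel_eq:
  fixes x y :: real
  assumes "T > 1" "orthonormal_polys_unit_circle (opuc_weight T) P"
    and "orthonormal_basis T n e" "N = 2 * n + 1"
  defines "z \<equiv> circle_point T x" and "w \<equiv> circle_point T y"
  shows "prolate_kernel N e x y
     = cnj z ^ n * w ^ n * (\<Sum>k<N. poly (P k) z * cnj (poly (P k) w))"
proof -
  define g where "g = (\<lambda>k x. cnj (circle_point T x) ^ n * poly (P k) (circle_point T x))"
  have "prolate_kernel N e x y = (\<Sum>k<N. g k x * cnj (g k y))"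
    unfolding prolate_kernel_def
  proof (rule reproducing_kernel_unique)
    show "L2_orthonormal {1..N} e"
      using assms(3) orthonormal_basis_continuous[OF assms(3)] assms(4)
      by (auto simp: L2_orthonormal_def orthonormal_basis_def)
    have "L2_inner (g j) (g k)
        = L2_inner (\<lambda>x. poly (P j) (circle_point T x)) (\<lambda>x. poly (P k) (circle_point T x))" for j k
    proof (rule L2_inner_cong)
      fix x
      have "g j x * cnj (g k x) = (circle_point T x * cnj (circle_point T x)) ^ n *
          (poly (P j) (circle_point T x) * cnj (poly (P k) (circle_point T x)))"
        by (simp add: g_def power_mult_distrib del: circle_point_mult_cnj)
      then show "g j x * cnj (g k x)
        = poly (P j) (circle_point T x) * cnj (poly (P k) (circle_point T x))" by simp
    qed
    then show "L2_orthonormal {..<N} g"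
      using L2_orthonormal_opuc[OF assms(1,2), of "{..<N}"]
      by (auto simp: L2_orthonormal_def g_def intro!: continuous_intros)
    show "cfun.span (e ` {1..N}) = cfun.span (g ` {..<N})"
      using assms(3) unfolding g_def span_opuc[OF assms(1,2)] assms(4) orthonormal_basis_def trig_space_eq
      by blast
  qed auto
  also have "\<dots> = (\<Sum>k<N. (cnj z ^ n * w ^ n) * (poly (P k) z * cnj (poly (P k) w)))"
    unfolding g_def z_def w_def
    by (simp only: complex_cnj_mult complex_cnj_power complex_cnj_cnj mult_ac)
  finally show ?thesis by (simp only: sum_distrib_left)
qed

lemma prolate_kernel_eq_cd_quotient:
  assumes "T > 1" "orthonormal_polys_unit_circle (opuc_weight T) P"
    and "orthonormal_basis T n e" "N = 2 * n + 1"
    and sin: "sin (pi / (2 * T) * (x - y)) \<noteq> 0"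
  shows "prolate_kernel N e x y = of_real (cd_quotient T N (P N) x y)"
proof -
  \<comment> \<open>Half-angle exponentials, needed for the half-integer power \<open>N / 2\<close> and for the sine.\<close>
  define s t where "s = exp (\<i> * of_real (pi / (2 * T) * x))" and "t = exp (\<i> * of_real (pi / (2 * T) * y))"
  define p q where "p = poly (P N) (circle_point T x)" and "q = poly (P N) (circle_point T y)"
  define S where "S = (\<Sum>k<N. poly (P k) (circle_point T x) * cnj (poly (P k) (circle_point T y)))"
  have [simp]: "s \<noteq> 0" "t \<noteq> 0" by (auto simp: s_def t_def)
  have z: "circle_point T x = s ^ 2" and w: "circle_point T y = t ^ 2"
    using assms(1)
    by (auto simp: circle_point_def s_def t_def field_simps simp flip: exp_of_nat_mult)
  have cs: "cnj s = inverse s" and ct: "cnj t = inverse t"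
    by (auto simp: s_def t_def exp_cnj simp flip: exp_minus)
  have sN: "exp (- (\<i> * of_real (pi / T) * of_real (real N / 2) * of_real x)) = inverse s ^ N"
    and tN: "exp (- (\<i> * of_real (pi / T) * of_real (real N / 2) * of_real y)) = inverse t ^ N"
    unfolding s_def t_def exp_minus[symmetric] exp_of_nat_mult[symmetric]
    by (simp_all add: field_simps)
  have quot: "s / t = exp (\<i> * of_real (pi / (2 * T) * (x - y)))"
      "t / s = exp (- (\<i> * of_real (pi / (2 * T) * (x - y))))"
    unfolding s_def t_def exp_diff[symmetric] right_diff_distrib of_real_diff minus_diff_eq
    by (rule refl)+
  have sin_eq: "of_real (sin (pi / (2 * T) * (x - y))) = (s / t - t / s) / (2 * \<i>)"
    unfolding sin_of_real[symmetric] sin_exp_eq quot ..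
  then have st: "s / t - t / s \<noteq> 0" using sin by auto
  define A where "A = t ^ N * cnj q * (inverse s ^ N * p)"
  have cA: "cnj A = inverse t ^ N * q * (s ^ N * cnj p)"
    by (simp add: A_def cs ct)
  have K: "prolate_kernel N e x y = inverse s ^ (2 * n) * t ^ (2 * n) * S"
    using prolate_kernel_eq[OF assms(1-4), of x y]
    unfolding S_def[symmetric]
    unfolding z w by (simp only: complex_cnj_power cs power_mult)
  have cd: "(1 - s ^ 2 * inverse t ^ 2) * S = s ^ (2 * N) * cnj p * (inverse t ^ (2 * N) * q) - p * cnj q"
    using christoffel_darboux[OF assms(1,2), of x y N]
    unfolding S_def[symmetric] p_def[symmetric] q_def[symmetric]
    unfolding z w by (simp add: ct power_mult)
  have h: "s / t - t / s = - (inverse s * t) * (1 - s ^ 2 * inverse t ^ 2)"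
    by (simp add: field_simps power2_eq_square)
  have "prolate_kernel N e x y * (s / t - t / s) =
      - (inverse s ^ N * t ^ N) * ((1 - s ^ 2 * inverse t ^ 2) * S)"
    unfolding K h unfolding assms(4) power_add power_one_right by (simp only: mult_ac mult_minus_left mult_minus_right)
  also have "\<dots> = (t ^ N * cnj q) * (inverse s ^ N * p)
      - (t ^ N * inverse t ^ (2 * N) * q) * (inverse s ^ N * s ^ (2 * N) * cnj p)"
    unfolding cd right_diff_distrib by (simp only: mult_ac mult_minus_left mult_minus_right) simp
  also have "t ^ N * inverse t ^ (2 * N) = inverse t ^ N"
    by (simp add: mult_2 power_add power_inverse)
  also have "inverse s ^ N * s ^ (2 * N) = s ^ N"
    by (simp add: mult_2 power_add power_inverse)
  also have "(t ^ N * cnj q) * (inverse s ^ N * p) - inverse t ^ N * q * (s ^ N * cnj p) = A - cnj A"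
    unfolding cA unfolding A_def ..
  finally have "prolate_kernel N e x y = (A - cnj A) / (s / t - t / s)"
    by (simp only: nonzero_eq_divide_eq[OF st])
  also have "\<dots> = of_real (Im A / sin (pi / (2 * T) * (x - y)))"
    unfolding of_real_divide sin_eq
    by (simp only: complex_diff_cnj divide_divide_eq_right of_real_mult of_real_numeral mult_ac)
  also have "Im A / sin (pi / (2 * T) * (x - y)) = cd_quotient T N (P N) x y"
    unfolding cd_quotient_def sN tN circle_point_def[symmetric] p_def[symmetric] q_def[symmetric]
    by (simp only: Im_divide_of_real A_def complex_cnj_mult complex_cnj_power complex_cnj_inverse ct
        inverse_inverse_eq mult.assoc)
  finally show ?thesis .
qed

lemma islimpt_sin_nonzero:
  fixes x y T :: real
  assumes "T > 0" and "sin (pi / (2 * T) * (x - y)) = 0"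
  shows "(x, y) islimpt {(u, v). sin (pi / (2 * T) * (u - v)) \<noteq> 0}"
  unfolding islimpt_approachable
proof (intro allI impI)
  fix r :: real assume "r > 0"
  define d where "d = min (r / 2) T"
  have d: "0 < d" "d < r" "d \<le> T" using \<open>r > 0\<close> assms(1) by (auto simp: d_def)
  have "sin (pi / (2 * T) * d) > 0"
    using d assms(1) by (intro sin_gt_zero) (auto simp: field_simps intro: le_less_trans)
  moreover have "cos (pi / (2 * T) * (x - y)) \<noteq> 0"
    using assms(2) sin_cos_squared_add[of "pi / (2 * T) * (x - y)"] by auto
  moreover have "pi / (2 * T) * (x + d - y) = pi / (2 * T) * (x - y) + pi / (2 * T) * d"
    by (simp only: distrib_left[symmetric] diff_add_eq)
  then have "sin (pi / (2 * T) * (x + d - y)) = cos (pi / (2 * T) * (x - y)) * sin (pi / (2 * T) * d)"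
    using assms(2) by (simp only: sin_add)
  ultimately have "(x + d, y) \<in> {(u, v). sin (pi / (2 * T) * (u - v)) \<noteq> 0}" by simp
  moreover have "dist (x + d, y) (x, y) < r" using d by (simp add: dist_Pair_Pair dist_norm)
  ultimately show "\<exists>x'\<in>{(u, v). sin (pi / (2 * T) * (u - v)) \<noteq> 0}. x' \<noteq> (x, y) \<and> dist x' (x, y) < r"
    using d by (intro bexI[of _ "(x + d, y)"]) auto
qed

lemma continuous_on_prolate_kernel:
  assumes "orthonormal_basis T n e"
  shows "continuous_on UNIV (\<lambda>(x, y). prolate_kernel (2 * n + 1) e x y)"
  unfolding prolate_kernel_def case_prod_unfold
  by (intro continuous_intros continuous_on_compose2[OF orthonormal_basis_continuous[OF assms]]) auto

text \<open>
  The identity holds for all real arguments.  At a zero of the sine it is obtained as a limit; the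
  kernel is real there because it is a limit of real values.
\<close>

lemma prolate_kernel_eq_cd_formula:
  assumes "T > 1" "orthonormal_polys_unit_circle (opuc_weight T) P"
    and "orthonormal_basis T n e" "N = 2 * n + 1"
  shows "prolate_kernel N e x y = of_real (cd_formula T N (P N) x y)"
proof (cases "sin (pi / (2 * T) * (x - y)) = 0")
  case False
  then show ?thesis
    using prolate_kernel_eq_cd_quotient[OF assms] by (simp add: cd_formula_def)
next
  case True
  define D where "D = {(u, v). sin (pi / (2 * T) * (u - v)) \<noteq> 0}"
  define F where "F = at (x, y) within D"
  have F: "F \<noteq> bot"
    using islimpt_sin_nonzero[of T x y] True assms(1)
    unfolding F_def D_def trivial_limit_within by auto
  have K: "((\<lambda>(u, v). prolate_kernel N e u v) \<longlongrightarrow> prolate_kernel N e x y) F"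
    using continuous_on_prolate_kernel[OF assms(3)] unfolding F_def assms(4)
    by (auto simp: continuous_on_def intro: tendsto_within_subset[of _ _ _ UNIV])
  have ev: "\<forall>\<^sub>F p in F. (\<lambda>(u, v). prolate_kernel N e u v) p
      = of_real ((\<lambda>(u, v). cd_quotient T N (P N) u v) p)"
    unfolding F_def eventually_at_filter
    by (rule always_eventually) (auto simp: D_def prolate_kernel_eq_cd_quotient[OF assms])
  have lim: "((\<lambda>p. complex_of_real ((\<lambda>(u, v). cd_quotient T N (P N) u v) p)) \<longlongrightarrow> prolate_kernel N e x y) F"
    using K ev by (rule Lim_transform_eventually)
  have "((\<lambda>p. Im (complex_of_real ((\<lambda>(u, v). cd_quotient T N (P N) u v) p))) \<longlongrightarrow> Im (prolate_kernel N e x y)) F"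
    using lim by (rule tendsto_Im)
  then have "((\<lambda>p. 0) \<longlongrightarrow> Im (prolate_kernel N e x y)) F" by simp
  then have Im: "Im (prolate_kernel N e x y) = 0"
    using F tendsto_const_iff by metis
  have "((\<lambda>p. Re (complex_of_real ((\<lambda>(u, v). cd_quotient T N (P N) u v) p))) \<longlongrightarrow> Re (prolate_kernel N e x y)) F"
    using lim by (rule tendsto_Re)
  then have "((\<lambda>(u, v). cd_quotient T N (P N) u v) \<longlongrightarrow> Re (prolate_kernel N e x y)) F" by simp
  then have "Lim F (\<lambda>(u, v). cd_quotient T N (P N) u v) = Re (prolate_kernel N e x y)"
    using F by (rule tendsto_Lim[rotated])
  then have "cd_formula T N (P N) x y = Re (prolate_kernel N e x y)"
    using True by (simp add: cd_formula_def F_def D_def)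
  then show ?thesis using Im by (simp add: complex_eq_iff)
qed

theorem lemma4p3:
  fixes T :: real and n N :: nat
    and e :: "nat \<Rightarrow> real \<Rightarrow> complex"
    and P :: "nat \<Rightarrow> complex poly"
  assumes "T > 1"
    and "N = 2 * n + 1"
    and "orthonormal_basis T n e"
    and "orthonormal_polys_unit_circle (opuc_weight T) P"
  shows "continuous_on ({-T..T} \<times> {-T..T}) (\<lambda>(x, y). cd_formula T N (P N) x y)
    \<and> (\<forall>x\<in>{-1..1}. \<forall>y\<in>{-1..1}.
          prolate_kernel N e x y = complex_of_real (cd_formula T N (P N) x y))
    \<and> (\<forall>x\<in>{-T..T}. \<forall>y\<in>{-T..T}.
          prolate_kernel N e x y = complex_of_real (cd_formula T N (P N) x y))"
proof -
  have eq: "prolate_kernel N e x y = complex_of_real (cd_formula T N (P N) x y)" for x y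
    by (rule prolate_kernel_eq_cd_formula[OF assms(1,4,3,2)])
  then have "cd_formula T N (P N) x y = Re (prolate_kernel N e x y)" for x y by simp
  then have "(\<lambda>(x, y). cd_formula T N (P N) x y) = (\<lambda>p. Re ((\<lambda>(x, y). prolate_kernel (2 * n + 1) e x y) p))"
    using assms(2) by auto
  moreover have "continuous_on ({-T..T} \<times> {-T..T})
      (\<lambda>p. Re ((\<lambda>(x, y). prolate_kernel (2 * n + 1) e x y) p))"
    using continuous_on_prolate_kernel[OF assms(3)] continuous_on_subset
    by (blast intro: continuous_on_Re)
  ultimately show ?thesis using eq by simp
qed

end
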